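(* Let $\wp$ be a quasi-ordered $RL$-Wajsberg algebra and let $\widehat{\wp}\subseteq\wp$. The following statements are equivalent: (i) $\widehat{\wp}$ is an implicative filter of $\wp$; (ii) $\widehat{\wp}$ is an implicative filter of $\wp$ and for any $\tau,k\in\wp$, $\tau\twoheadrightarrow(\tau\twoheadrightarrow k)\in\widehat{\wp}$ implies $\tau\twoheadrightarrow k\in\widehat{\wp}$; (iii) $\widehat{\wp}$ is an implicative filter of $\wp$ and for any $\tau,\varsigma,k\in\wp$, $\tau\twoheadrightarrow(\varsigma\twoheadrightarrow k)\in\widehat{\wp}$ implies $(\tau\twoheadrightarrow\varsigma)\twoheadrightarrow(\tau\twoheadrightarrow k)\in\widehat{\wp}$; (iv) $1\in\widehat{\wp}$ and for any $\tau,\varsigma,k\in\wp$, $\varsigma\twoheadrightarrow(\tau\twoheadrightarrow(\tau\twoheadrightarrow k))\in\widehat{\wp}$ and $\varsigma\in\widehat{\wp}$ imply $\tau\twoheadrightarrow k\in\widehat{\wp}$.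
   Context: A Wajsberg algebra is a set $\wp$ with a binary operation $\twoheadrightarrow$, a unary operation $\neg$ and a constant $1$ such that for all $x,y,z\in\wp$: $1\twoheadrightarrow x=x$; $(x\twoheadrightarrow y)\twoheadrightarrow((y\twoheadrightarrow z)\twoheadrightarrow(x\twoheadrightarrow z))=1$; $(x\twoheadrightarrow y)\twoheadrightarrow y=(y\twoheadrightarrow x)\twoheadrightarrow x$; $(\neg x\twoheadrightarrow\neg y)\twoheadrightarrow(y\twoheadrightarrow x)=1$. A quasi-ordered $RL$-Wajsberg algebra ($RL$ stands for residuated lattice) is a Wajsberg algebra $\wp$ together with a binary operation $\odot$ and a quasi-order (reflexive transitive relation) $\leq$ on $\wp$ such that $(\wp,\odot,1)$ is a commutative monoid, $x\leq 1$ for all $x$, $x\odot y\leq z$ if and only if $x\leq y\twoheadrightarrow z$ for all $x,y,z$, and $x\leq y$ if and only if $x\twoheadrightarrow y=1$ for all $x,y$. A subset $\mathcal{M}\subseteq\wp$ is an implicative filter of $\wp$ if for all $r,p,k\in\wp$: (1) $1\in\mathcal{M}$; (2) if $r\in\mathcal{M}$ and $r\leq p$ then $p\in\mathcal{M}$; (3) if $r\twoheadrightarrow(p\twoheadrightarrow k)\in\mathcal{M}$ and $r\twoheadrightarrow p\in\mathcal{M}$ then $r\twoheadrightarrow k\in\mathcal{M}$. *)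

theory Defs
  imports "HOL-Algebra.Group"
begin

locale Wajsberg_algebra =
  fixes C :: "'a set"
    and imp :: "'a \<Rightarrow> 'a \<Rightarrow> 'a" (infixr \<open>\<leadsto>\<close> 65)
    and neg :: "'a \<Rightarrow> 'a" (\<open>\<sim>_\<close> [81] 80)
    and u :: 'a (\<open>\<^bold>1\<close>)
  assumes imp_closed: "\<lbrakk>x \<in> C; y \<in> C\<rbrakk> \<Longrightarrow> x \<leadsto> y \<in> C"
    and neg_closed: "x \<in> C \<Longrightarrow> \<sim>x \<in> C"
    and unit_closed: "\<^bold>1 \<in> C"
    and unit_imp: "x \<in> C \<Longrightarrow> \<^bold>1 \<leadsto> x = x"
    and imp_trans:
      "\<lbrakk>x \<in> C; y \<in> C; z \<in> C\<rbrakk> \<Longrightarrow> (x \<leadsto> y) \<leadsto> ((y \<leadsto> z) \<leadsto> (x \<leadsto> z)) = \<^bold>1"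
    and imp_imp_commute:
      "\<lbrakk>x \<in> C; y \<in> C\<rbrakk> \<Longrightarrow> (x \<leadsto> y) \<leadsto> y = (y \<leadsto> x) \<leadsto> x"
    and contraposition:
      "\<lbrakk>x \<in> C; y \<in> C\<rbrakk> \<Longrightarrow> (\<sim>x \<leadsto> \<sim>y) \<leadsto> (y \<leadsto> x) = \<^bold>1"

locale quasi_ordered_RL_Wajsberg_algebra =
  Wajsberg_algebra C imp neg u
  for C :: "'a set"
    and imp :: "'a \<Rightarrow> 'a \<Rightarrow> 'a" (infixr \<open>\<leadsto>\<close> 65)
    and neg :: "'a \<Rightarrow> 'a" (\<open>\<sim>_\<close> [81] 80)
    and u :: 'a (\<open>\<^bold>1\<close>) +
  fixes mul :: "'a \<Rightarrow> 'a \<Rightarrow> 'a" (infixl \<open>\<odot>\<close> 70)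
    and qo :: "'a \<Rightarrow> 'a \<Rightarrow> bool" (infix \<open>\<sqsubseteq>\<close> 50)
  assumes comm_monoid_mul:
      "comm_monoid \<lparr>carrier = C, monoid.mult = (\<odot>), one = \<^bold>1\<rparr>"
    and qo_reflp_on: "reflp_on C (\<sqsubseteq>)"
    and qo_transp_on: "transp_on C (\<sqsubseteq>)"
    and qo_unit: "x \<in> C \<Longrightarrow> x \<sqsubseteq> \<^bold>1"
    and residuation:
      "\<lbrakk>x \<in> C; y \<in> C; z \<in> C\<rbrakk> \<Longrightarrow> x \<odot> y \<sqsubseteq> z \<longleftrightarrow> x \<sqsubseteq> y \<leadsto> z"
    and qo_iff_imp: "\<lbrakk>x \<in> C; y \<in> C\<rbrakk> \<Longrightarrow> x \<sqsubseteq> y \<longleftrightarrow> x \<leadsto> y = \<^bold>1"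

definition implicative_filter ::
    "'a set \<Rightarrow> ('a \<Rightarrow> 'a \<Rightarrow> 'a) \<Rightarrow> 'a \<Rightarrow> ('a \<Rightarrow> 'a \<Rightarrow> bool) \<Rightarrow> 'a set \<Rightarrow> bool" where
  "implicative_filter C imp u qo M \<longleftrightarrow>
     M \<subseteq> C \<and>
     u \<in> M \<and>
     (\<forall>r\<in>C. \<forall>p\<in>C. r \<in> M \<and> qo r p \<longrightarrow> p \<in> M) \<and>
     (\<forall>r\<in>C. \<forall>p\<in>C. \<forall>k\<in>C. imp r (imp p k) \<in> M \<and> imp r p \<in> M \<longrightarrow> imp r k \<in> M)"

end

theory Submission
  imports Defs
begin

text \<open>
  An implicative filter is the same as a set containing \<open>\<^bold>1\<close> that is closed under modus ponens and
  under contraction, i.e. the passage from \<open>x \<leadsto> (x \<leadsto> y)\<close> to \<open>x \<leadsto> y\<close>. Condition (iv) packs both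
  closures into one rule: \<open>\<tau> = \<^bold>1\<close> gives modus ponens and \<open>\<sigma> = \<^bold>1\<close> gives contraction. Everything
  else follows from the exchange law \<open>x \<leadsto> (y \<leadsto> z) = y \<leadsto> (x \<leadsto> z)\<close>, which residuation
  reduces to commutativity of the product.
\<close>

context quasi_ordered_RL_Wajsberg_algebra
begin

lemma mul_closed: "\<lbrakk>x \<in> C; y \<in> C\<rbrakk> \<Longrightarrow> x \<odot> y \<in> C"
  using monoid.m_closed[OF comm_monoid.axioms(1)[OF comm_monoid_mul], of x y] by simp

lemma mul_right_commute: "\<lbrakk>x \<in> C; y \<in> C; z \<in> C\<rbrakk> \<Longrightarrow> x \<odot> y \<odot> z = x \<odot> z \<odot> y"
  using monoid.m_assoc[OF comm_monoid.axioms(1)[OF comm_monoid_mul], of x y z]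
    monoid.m_assoc[OF comm_monoid.axioms(1)[OF comm_monoid_mul], of x z y]
    comm_monoid.m_comm[OF comm_monoid_mul, of y z] by simp

lemma imp_refl: "x \<in> C \<Longrightarrow> x \<leadsto> x = \<^bold>1"
  using qo_reflp_on qo_iff_imp by (auto dest: reflp_onD)

text \<open>When both implications are the unit, \<open>imp_imp_commute\<close> collapses to
  \<open>u \<leadsto> y = u \<leadsto> x\<close>. The quasi-order is thus a partial order, so an
  equation may be proved by two inequalities.\<close>

lemma qo_antisym:
  assumes "x \<in> C" "y \<in> C" "x \<sqsubseteq> y" "y \<sqsubseteq> x"
  shows "x = y"
  using imp_imp_commute[of x y] assms by (simp add: qo_iff_imp unit_imp)

lemma imp_exchange_le:
  assumes "x \<in> C" "y \<in> C" "z \<in> C"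
  shows "x \<leadsto> (y \<leadsto> z) \<sqsubseteq> y \<leadsto> (x \<leadsto> z)"
proof -
  let ?w = "x \<leadsto> (y \<leadsto> z)"
  have w: "?w \<in> C"
    using assms by (simp add: imp_closed)
  have "?w \<sqsubseteq> ?w"
    using qo_reflp_on w by (rule reflp_onD)
  \<comment> \<open>Residuation is applied twice to \<open>?w \<sqsubseteq> ?w\<close>, moving both
    premises \<open>x\<close> and \<open>y\<close> into the product, where they can be
    swapped.\<close>
  then have "?w \<odot> x \<odot> y \<sqsubseteq> z"
    using assms w by (simp add: residuation imp_closed mul_closed)
  then have "?w \<odot> y \<odot> x \<sqsubseteq> z"
    unfolding mul_right_commute[OF w assms(1,2)] .
  then show ?thesis
    using assms w by (simp add: residuation imp_closed mul_closed)
qed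

lemma imp_exchange: "\<lbrakk>x \<in> C; y \<in> C; z \<in> C\<rbrakk> \<Longrightarrow> x \<leadsto> (y \<leadsto> z) = y \<leadsto> (x \<leadsto> z)"
  by (rule qo_antisym) (simp_all add: imp_exchange_le imp_closed)

text \<open>Transitivity \<open>imp_trans\<close> with its two premises exchanged.\<close>

lemma imp_prefix:
  "\<lbrakk>x \<in> C; y \<in> C; z \<in> C\<rbrakk> \<Longrightarrow> (y \<leadsto> z) \<leadsto> ((x \<leadsto> y) \<leadsto> (x \<leadsto> z)) = \<^bold>1"
  using imp_trans[of x y z] by (simp add: imp_exchange[of "x \<leadsto> y" "y \<leadsto> z" "x \<leadsto> z"] imp_closed)

text \<open>Stated from the closure rules alone, so that it serves both to derive a property of a
  filter and to establish that a set is one.\<close>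

lemma filter_mp_contraction_distrib:
  assumes one: "\<^bold>1 \<in> F"
    and mp: "\<And>x y. \<lbrakk>x \<in> C; y \<in> C; x \<leadsto> y \<in> F; x \<in> F\<rbrakk> \<Longrightarrow> y \<in> F"
    and contraction: "\<And>x y. \<lbrakk>x \<in> C; y \<in> C; x \<leadsto> (x \<leadsto> y) \<in> F\<rbrakk> \<Longrightarrow> x \<leadsto> y \<in> F"
    and C: "x \<in> C" "y \<in> C" "z \<in> C"
    and F: "x \<leadsto> (y \<leadsto> z) \<in> F"
  shows "(x \<leadsto> y) \<leadsto> (x \<leadsto> z) \<in> F"
proof -
  let ?s = "x \<leadsto> y"
  have s: "?s \<in> C"
    using C by (simp add: imp_closed)
  \<comment> \<open>Prefixing by \<open>x\<close> an implication that already has \<open>x\<close>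
    as a premise creates the doubled premise that contraction needs.\<close>
  have "(y \<leadsto> (x \<leadsto> z)) \<leadsto> (?s \<leadsto> (x \<leadsto> (x \<leadsto> z))) \<in> F"
    using C one by (simp add: imp_prefix imp_closed)
  moreover have "y \<leadsto> (x \<leadsto> z) \<in> F"
    using F C by (simp add: imp_exchange[of y x z])
  ultimately have "?s \<leadsto> (x \<leadsto> (x \<leadsto> z)) \<in> F"
    using C s by (intro mp[of "y \<leadsto> (x \<leadsto> z)" "?s \<leadsto> (x \<leadsto> (x \<leadsto> z))"] imp_closed)
  \<comment> \<open>Two exchanges carry \<open>?s\<close> inward past both copies of
    \<open>x\<close>, which then stand in front, ready to be contracted.\<close>
  moreover have "?s \<leadsto> (x \<leadsto> (x \<leadsto> z)) = x \<leadsto> (x \<leadsto> (?s \<leadsto> z))"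
    using C s by (simp add: imp_exchange[of ?s x "x \<leadsto> z"] imp_exchange[of ?s x z] imp_closed)
  ultimately have "x \<leadsto> (?s \<leadsto> z) \<in> F"
    using C s by (intro contraction[of x "?s \<leadsto> z"] imp_closed) simp_all
  then show ?thesis
    using C s by (simp add: imp_exchange[of ?s x z])
qed

text \<open>The third filter condition with \<open>r\<close> the unit.\<close>

lemma implicative_filter_mp:
  assumes "implicative_filter C (\<leadsto>) \<^bold>1 (\<sqsubseteq>) F" "x \<in> C" "y \<in> C" "x \<leadsto> y \<in> F" "x \<in> F"
  shows "y \<in> F"
proof -
  have "\<^bold>1 \<leadsto> (x \<leadsto> y) \<in> F" "\<^bold>1 \<leadsto> x \<in> F"
    using assms by (simp_all add: unit_imp imp_closed)
  then have "\<^bold>1 \<leadsto> y \<in> F"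
    using assms(1-3) unit_closed unfolding implicative_filter_def by blast
  then show ?thesis
    using assms by (simp add: unit_imp)
qed

text \<open>The third filter condition with \<open>r = p = x\<close>, whose side premise
  \<open>x \<leadsto> x\<close> is the unit.\<close>

lemma implicative_filter_contraction:
  assumes "implicative_filter C (\<leadsto>) \<^bold>1 (\<sqsubseteq>) F" "x \<in> C" "y \<in> C" "x \<leadsto> (x \<leadsto> y) \<in> F"
  shows "x \<leadsto> y \<in> F"
proof -
  have "x \<leadsto> x \<in> F"
    using assms(1,2) by (simp add: imp_refl implicative_filter_def)
  then show ?thesis
    using assms unfolding implicative_filter_def by blast
qed

text \<open>For the converse, upward closure is modus ponens, since \<open>r \<sqsubseteq> p\<close>
  makes \<open>r \<leadsto> p\<close> the unit; the third condition is distribution followed by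
  modus ponens.\<close>

lemma implicative_filter_iff_mp_contraction:
  assumes "F \<subseteq> C"
  shows "implicative_filter C (\<leadsto>) \<^bold>1 (\<sqsubseteq>) F \<longleftrightarrow>
    \<^bold>1 \<in> F \<and>
    (\<forall>x\<in>C. \<forall>y\<in>C. x \<leadsto> y \<in> F \<and> x \<in> F \<longrightarrow> y \<in> F) \<and>
    (\<forall>x\<in>C. \<forall>y\<in>C. x \<leadsto> (x \<leadsto> y) \<in> F \<longrightarrow> x \<leadsto> y \<in> F)"
    (is "?filter \<longleftrightarrow> ?one \<and> ?mp \<and> ?contraction")
proof
  assume ?filter
  moreover from this have ?one
    by (simp add: implicative_filter_def)
  ultimately show "?one \<and> ?mp \<and> ?contraction"
    using implicative_filter_mp implicative_filter_contraction by blast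
next
  assume "?one \<and> ?mp \<and> ?contraction"
  then have one: "\<^bold>1 \<in> F"
    and mp: "\<And>x y. \<lbrakk>x \<in> C; y \<in> C; x \<leadsto> y \<in> F; x \<in> F\<rbrakk> \<Longrightarrow> y \<in> F"
    and contraction: "\<And>x y. \<lbrakk>x \<in> C; y \<in> C; x \<leadsto> (x \<leadsto> y) \<in> F\<rbrakk> \<Longrightarrow> x \<leadsto> y \<in> F"
    by blast+
  have "\<forall>r\<in>C. \<forall>p\<in>C. r \<in> F \<and> r \<sqsubseteq> p \<longrightarrow> p \<in> F"
  proof (intro ballI impI, elim conjE)
    fix r p
    assume r: "r \<in> C" "p \<in> C" "r \<in> F" "r \<sqsubseteq> p"
    have "r \<leadsto> p \<in> F"
      using r one by (simp add: qo_iff_imp)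
    then show "p \<in> F"
      by (rule mp[OF r(1,2) _ r(3)])
  qed
  moreover have "\<forall>r\<in>C. \<forall>p\<in>C. \<forall>k\<in>C.
    r \<leadsto> (p \<leadsto> k) \<in> F \<and> r \<leadsto> p \<in> F \<longrightarrow> r \<leadsto> k \<in> F"
  proof (intro ballI impI, elim conjE)
    fix r p k
    assume r: "r \<in> C" "p \<in> C" "k \<in> C" "r \<leadsto> (p \<leadsto> k) \<in> F" "r \<leadsto> p \<in> F"
    have "(r \<leadsto> p) \<leadsto> (r \<leadsto> k) \<in> F"
      using one mp contraction r(1-4) by (rule filter_mp_contraction_distrib)
    then show "r \<leadsto> k \<in> F"
      using r by (intro mp[of "r \<leadsto> p" "r \<leadsto> k"] imp_closed)
  qed
  ultimately show ?filter
    using one assms unfolding implicative_filter_def by (intro conjI)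
qed

lemma implicative_filter_distrib:
  assumes "implicative_filter C (\<leadsto>) \<^bold>1 (\<sqsubseteq>) F"
    and "x \<in> C" "y \<in> C" "z \<in> C" "x \<leadsto> (y \<leadsto> z) \<in> F"
  shows "(x \<leadsto> y) \<leadsto> (x \<leadsto> z) \<in> F"
proof -
  have "\<^bold>1 \<in> F"
    using assms(1) by (simp add: implicative_filter_def)
  then show ?thesis
    using implicative_filter_mp[OF assms(1)] implicative_filter_contraction[OF assms(1)] assms(2-)
    by (rule filter_mp_contraction_distrib)
qed

lemma implicative_filter_iff_guarded_contraction:
  assumes "F \<subseteq> C"
  shows "implicative_filter C (\<leadsto>) \<^bold>1 (\<sqsubseteq>) F \<longleftrightarrow>
    \<^bold>1 \<in> F \<and>
    (\<forall>x\<in>C. \<forall>y\<in>C. \<forall>z\<in>C. y \<leadsto> (x \<leadsto> (x \<leadsto> z)) \<in> F \<and> y \<in> F \<longrightarrow> x \<leadsto> z \<in> F)"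
    (is "?filter \<longleftrightarrow> ?one \<and> ?guarded")
proof
  assume ?filter
  then show "?one \<and> ?guarded"
    \<comment> \<open>Modus ponens discharges the guard \<open>y\<close>, and contraction then
      merges the two copies of \<open>x\<close>.\<close>
    unfolding implicative_filter_iff_mp_contraction[OF assms] using imp_closed by blast
next
  assume R: "?one \<and> ?guarded"
  have "y \<in> F" if "x \<in> C" "y \<in> C" "x \<leadsto> y \<in> F" "x \<in> F" for x y
  proof -
    have "x \<leadsto> (\<^bold>1 \<leadsto> (\<^bold>1 \<leadsto> y)) \<in> F"
      using that by (simp add: unit_imp)
    then have "\<^bold>1 \<leadsto> y \<in> F"
      using R that unit_closed by blast
    then show ?thesis
      using that by (simp add: unit_imp)
  qed
  moreover have "x \<leadsto> y \<in> F" if "x \<in> C" "y \<in> C" "x \<leadsto> (x \<leadsto> y) \<in> F" for x y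
  proof -
    have "\<^bold>1 \<leadsto> (x \<leadsto> (x \<leadsto> y)) \<in> F"
      using that by (simp add: unit_imp imp_closed)
    then show ?thesis
      using R that unit_closed by blast
  qed
  ultimately show ?filter
    using R unfolding implicative_filter_iff_mp_contraction[OF assms] by blast
qed

end

theorem proposition2p1p9:
  fixes C F :: "'a set"
    and imp :: "'a \<Rightarrow> 'a \<Rightarrow> 'a" (infixr \<open>\<leadsto>\<close> 65)
    and neg :: "'a \<Rightarrow> 'a"
    and u :: 'a (\<open>\<^bold>1\<close>)
    and mul :: "'a \<Rightarrow> 'a \<Rightarrow> 'a"
    and qo :: "'a \<Rightarrow> 'a \<Rightarrow> bool"
  assumes "quasi_ordered_RL_Wajsberg_algebra C (\<leadsto>) neg \<^bold>1 mul qo"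
    and "F \<subseteq> C"
  shows "(implicative_filter C (\<leadsto>) \<^bold>1 qo F \<longleftrightarrow>
    (implicative_filter C (\<leadsto>) \<^bold>1 qo F \<and>
      (\<forall>\<tau>\<in>C. \<forall>k\<in>C. \<tau> \<leadsto> (\<tau> \<leadsto> k) \<in> F \<longrightarrow> \<tau> \<leadsto> k \<in> F))) \<and>
   (implicative_filter C (\<leadsto>) \<^bold>1 qo F \<longleftrightarrow>
    (implicative_filter C (\<leadsto>) \<^bold>1 qo F \<and>
      (\<forall>\<tau>\<in>C. \<forall>\<sigma>\<in>C. \<forall>k\<in>C.
        \<tau> \<leadsto> (\<sigma> \<leadsto> k) \<in> F \<longrightarrow> (\<tau> \<leadsto> \<sigma>) \<leadsto> (\<tau> \<leadsto> k) \<in> F))) \<and>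
   (implicative_filter C (\<leadsto>) \<^bold>1 qo F \<longleftrightarrow>
    (\<^bold>1 \<in> F \<and>
      (\<forall>\<tau>\<in>C. \<forall>\<sigma>\<in>C. \<forall>k\<in>C.
        \<sigma> \<leadsto> (\<tau> \<leadsto> (\<tau> \<leadsto> k)) \<in> F \<and> \<sigma> \<in> F \<longrightarrow> \<tau> \<leadsto> k \<in> F)))"
proof -
  interpret quasi_ordered_RL_Wajsberg_algebra C imp neg u mul qo
    by (rule assms(1))
  show ?thesis
    \<comment> \<open>Read from right to left, the characterization folds (iv) into the filter
      predicate, making that equivalence trivial. The extra clauses of (ii) and (iii) hold in every
      filter.\<close>
    unfolding implicative_filter_iff_guarded_contraction[OF assms(2), symmetric]
    using implicative_filter_contraction implicative_filter_distrib by blast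
qed

end
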